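(* Let $c\in\mathbb C$ have real part $a$, and let $R(c)=\{\sigma_c(n)\colon n\in\mathbb N\}$. (i) If $a<0$, then $R(c)$ has no isolated points. (ii) If $a=0$ and $c\neq 0$, then $R(c)$ is dense in $\mathbb C$ (and, therefore, has no isolated points). (iii) If $a>0$ or $c=0$, then every point of $R(c)$ is an isolated point of $R(c)$.
   Context: $\mathbb N$ is the set of positive integers. For $c\in\mathbb C$, the divisor function $\sigma_c\colon\mathbb N\to\mathbb C$ is $\sigma_c(n)=\sum_{d\mid n}d^c$ (sum over positive divisors $d$ of $n$), where $d^c=e^{c\log d}$ with the real logarithm $\log d$. Isolated points are with respect to the usual topology of $\mathbb C$. *)

theory Defs
  imports "HOL-Analysis.Analysis"
begin

text \<open>
  Only the values at \<open>n > 0\<close> are meaningful: every natural number divides \<open>0\<close>,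
  so the index set is infinite for \<open>n = 0\<close>.
\<close>
definition divisor_sigma :: "complex \<Rightarrow> nat \<Rightarrow> complex" where
  "divisor_sigma c n = (\<Sum>d | d dvd n. exp (c * complex_of_real (ln (real d))))"

definition divisor_range :: "complex \<Rightarrow> complex set" where
  "divisor_range c = {divisor_sigma c n | n. n > 0}"

end

theory Submission
  imports Defs "HOL-Computational_Algebra.Primes" "HOL-Real_Asymp.Real_Asymp"
begin

text \<open>
  Everything rests on multiplicativity: \<open>\<sigma>\<^sub>c(n)\<close> is the product of the geometric sums
  \<open>\<sigma>\<^sub>c(p\<^sup>k) = (1 - u\<^bsup>k+1\<^esup>) / (1 - u)\<close> with \<open>u = p\<^sup>c\<close>, over the prime powers exactly dividing \<open>n\<close>.
  Let \<open>a\<close> be the real part of \<open>c\<close>, so that \<open>\<bar>u\<bar> = p\<^sup>a\<close>.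

  If \<open>a < 0\<close>, then no value is zero, and \<open>\<sigma>\<^sub>c(n p) = \<sigma>\<^sub>c(n) (1 + p\<^sup>c)\<close> for the primes \<open>p > n\<close> is a
  sequence of values different from \<open>\<sigma>\<^sub>c(n)\<close> and converging to it.

  If \<open>a > 0\<close>, then \<open>\<bar>\<sigma>\<^sub>c(q)\<bar>\<close> is at least a constant times \<open>q\<^sup>a\<close> on prime powers \<open>q\<close>. The
  constant may be below \<open>1\<close>, but it is absorbed by half of the exponent for all but finitely many
  primes; so \<open>\<bar>\<sigma>\<^sub>c(n)\<bar>\<close> is at least a constant times \<open>n\<^bsup>a/2\<^esup>\<close>
  (\<open>norm_divisor_sigma_ge\<close>), and every disc contains only finitely many values. For \<open>c = 0\<close> the
  values are natural numbers.

  The case \<open>c = i b\<close> with \<open>b \<noteq> 0\<close> carries the weight. Here \<open>u = p\<^bsup>ib\<^esup>\<close> is on the unit circle. If it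
  is not a root of unity, which excludes at most one prime, its powers are dense there, so the
  values \<open>\<sigma>\<^sub>c(p\<^sup>k)\<close> are dense in a circle
  through \<open>0\<close>. Inversion turns that circle into a line: its nonzero points are the inverses of
  \<open>((1 - u) / 2) (1 + i y)\<close> with \<open>y\<close> real (\<open>closure_divisor_sigma_prime_powers\<close>). By
  multiplicativity, the closure of the range contains the inverse of
  \<open>\<Prod>\<^sub>p ((1 - u\<^sub>p) / 2) \<cdot> \<Prod>\<^sub>p (1 + i y\<^sub>p)\<close> for each finite set of such primes and all choices of the
  \<open>y\<^sub>p\<close>. Already three factors \<open>1 + i y\<close> produce every complex number of modulus at least \<open>10\<close>
  (\<open>product_of_three_vertical_line_points\<close>). So every nonzero number is reached as soon as the
  first product can be made arbitrarily small, and for that it suffices that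
  \<open>\<bar>1 - u\<^sub>p\<bar> / 2\<close> is bounded away from \<open>1\<close> for infinitely many \<open>p\<close>, that is, that \<open>p\<^bsup>ib\<^esup>\<close> does not
  converge to \<open>-1\<close> along the primes.

  Otherwise \<open>p\<^bsup>2ib\<^esup>\<close> would converge to \<open>1\<close>. Comparing Euler products for \<open>\<sigma> > 1\<close> would then give
  \<open>\<zeta>(\<sigma>) \<le> K \<bar>\<zeta>(\<sigma> + 2ib)\<bar>\<^sup>2\<close> with \<open>K\<close> independent of \<open>\<sigma>\<close>. But the left-hand side is unbounded as
  \<open>\<sigma>\<close> tends to \<open>1\<close>, while the right-hand side is bounded (\<open>infinite_primes_cos_less\<close>).
\<close>

section \<open>Multiplicativity of the divisor function\<close>

definition nat_cpow :: "complex \<Rightarrow> nat \<Rightarrow> complex" where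
  "nat_cpow c n = exp (c * complex_of_real (ln (real n)))"

lemma nat_cpow_1 [simp]: "nat_cpow c (Suc 0) = 1"
  by (simp add: nat_cpow_def)

lemma nat_cpow_nonzero [simp]: "nat_cpow c n \<noteq> 0"
  by (simp add: nat_cpow_def)

lemma nat_cpow_mult:
  assumes "m > 0" "n > 0"
  shows "nat_cpow c (m * n) = nat_cpow c m * nat_cpow c n"
  using assms by (simp add: nat_cpow_def ln_mult algebra_simps flip: exp_add)

lemma nat_cpow_power:
  assumes "n > 0"
  shows "nat_cpow c (n ^ k) = nat_cpow c n ^ k"
  using assms by (induction k) (simp_all add: nat_cpow_mult)

lemma norm_nat_cpow:
  assumes "n > 0"
  shows "norm (nat_cpow c n) = real n powr Re c"
  using assms by (simp add: nat_cpow_def powr_def)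

lemma divisor_sigma_altdef: "divisor_sigma c n = (\<Sum>d | d dvd n. nat_cpow c d)"
  by (simp add: divisor_sigma_def nat_cpow_def)

lemma divisor_sigma_1 [simp]: "divisor_sigma c (Suc 0) = 1"
  by (simp add: divisor_sigma_altdef)

lemma divisor_sigma_mult_coprime:
  assumes "coprime m n" "m > 0" "n > 0"
  shows "divisor_sigma c (m * n) = divisor_sigma c m * divisor_sigma c n"
proof -
  have inj: "inj_on (\<lambda>(d, e). d * e) ({d. d dvd m} \<times> {e. e dvd n})"
  proof (rule inj_onI, clarify)
    have *: "d dvd d'" if "d dvd m" "e' dvd n" "d * e = d' * e'" for d e d' e'
      using that assms(1) by (metis coprime_divisors coprime_dvd_mult_left_iff dvd_triv_left)
    fix d e d' e' assume d: "d dvd m" "e dvd n" "d' dvd m" "e' dvd n" "d * e = d' * e'"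
    then have "d = d'"
      using *[of d e' e d'] *[of d' e e' d] by (simp add: dvd_antisym)
    moreover have "d > 0"
      using d assms(2) by (auto intro: dvd_pos_nat)
    ultimately show "d = d' \<and> e = e'"
      using d by simp
  qed
  have img: "(\<lambda>(d, e). d * e) ` ({d. d dvd m} \<times> {e. e dvd n}) = {d. d dvd m * n}"
  proof (intro equalityI subsetI)
    fix x assume "x \<in> {d. d dvd m * n}"
    then obtain d e where "x = d * e" "d dvd m" "e dvd n"
      using division_decomp[of x m n] by blast
    then show "x \<in> (\<lambda>(d, e). d * e) ` ({d. d dvd m} \<times> {e. e dvd n})"
      by auto
  qed (auto simp: mult_dvd_mono)
  have "divisor_sigma c (m * n) =
      (\<Sum>(d, e)\<in>{d. d dvd m} \<times> {e. e dvd n}. nat_cpow c (d * e))"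
    unfolding divisor_sigma_altdef img[symmetric]
    by (subst sum.reindex[OF inj]) (simp add: case_prod_unfold)
  also have "\<dots> = (\<Sum>(d, e)\<in>{d. d dvd m} \<times> {e. e dvd n}. nat_cpow c d * nat_cpow c e)"
    using assms by (intro sum.cong) (auto intro!: nat_cpow_mult dest: dvd_pos_nat)
  also have "\<dots> = divisor_sigma c m * divisor_sigma c n"
    by (simp add: divisor_sigma_altdef sum_product sum.cartesian_product)
  finally show ?thesis .
qed

lemma divisor_sigma_prime_power:
  assumes "prime p"
  shows "divisor_sigma c (p ^ k) = (\<Sum>i\<le>k. nat_cpow c p ^ i)"
proof -
  have inj: "inj_on ((^) p) {..k}"
    using assms by (auto intro!: inj_onI dest: prime_gt_1_nat)
  have "{d. d dvd p ^ k} = (^) p ` {..k}"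
    using assms by (auto simp: divides_primepow_nat)
  then have "divisor_sigma c (p ^ k) = (\<Sum>i\<le>k. nat_cpow c (p ^ i))"
    using inj by (simp add: divisor_sigma_altdef sum.reindex)
  then show ?thesis
    using assms by (simp add: nat_cpow_power prime_gt_0_nat)
qed

lemma divisor_sigma_prime_power_mult:
  assumes "prime p"
  shows "divisor_sigma c (p ^ k) * (1 - nat_cpow c p) = 1 - nat_cpow c p ^ Suc k"
  by (simp only: divisor_sigma_prime_power[OF assms] sum_gp_basic mult.commute)

lemma divisor_sigma_prod_prime_powers:
  assumes "finite F" "\<And>p. p \<in> F \<Longrightarrow> prime p"
  shows "divisor_sigma c (\<Prod>p\<in>F. p ^ k p) = (\<Prod>p\<in>F. divisor_sigma c (p ^ k p))"
  using assms
proof (induction F rule: finite_induct)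
  case (insert p F)
  have "coprime (p ^ k p) (\<Prod>q\<in>F. q ^ k q)"
    using insert by (intro prod_coprime_right)
      (auto intro!: coprime_power_left_iff[THEN iffD2] coprime_power_right_iff[THEN iffD2]
        disjI1 primes_coprime)
  moreover have "p ^ k p > 0" "(\<Prod>q\<in>F. q ^ k q) > 0"
    using insert.prems by (auto intro!: prod_pos simp: prime_gt_0_nat)
  ultimately show ?case
    using insert by (simp add: divisor_sigma_mult_coprime)
qed simp

lemma divisor_sigma_eq_prod:
  assumes "n > 0"
  shows "divisor_sigma c n = (\<Prod>p\<in>prime_factors n. divisor_sigma c (p ^ multiplicity p n))"
proof -
  have "n = (\<Prod>p\<in>prime_factors n. p ^ multiplicity p n)"
    using assms by (simp add: prime_factorization_nat)
  then have "divisor_sigma c n = divisor_sigma c (\<Prod>p\<in>prime_factors n. p ^ multiplicity p n)"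
    by simp
  also have "\<dots> = (\<Prod>p\<in>prime_factors n. divisor_sigma c (p ^ multiplicity p n))"
    by (rule divisor_sigma_prod_prime_powers) auto
  finally show ?thesis .
qed

section \<open>Exponents with negative real part\<close>

text \<open>
  A zero at a prime power would force \<open>p\<^bsup>c(k+1)\<^esup> = 1\<close>, but this number has modulus \<open>p\<^bsup>a(k+1)\<^esup> \<noteq> 1\<close>.
\<close>

lemma divisor_sigma_nonzero:
  assumes "Re c \<noteq> 0" "n > 0"
  shows "divisor_sigma c n \<noteq> 0"
proof -
  have "divisor_sigma c (p ^ k) \<noteq> 0" if p: "prime p" for p k
  proof
    assume "divisor_sigma c (p ^ k) = 0"
    then have "nat_cpow c (p ^ Suc k) = 1"
      using divisor_sigma_prime_power_mult[OF p, of c k] p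
      by (simp add: nat_cpow_power prime_gt_0_nat del: power_Suc)
    moreover have "real (p ^ Suc k) > 1"
      using prime_gt_1_nat[OF p] one_less_power[of p "Suc k"] by (simp del: power_Suc of_nat_power)
    ultimately show False
      using norm_nat_cpow[of "p ^ Suc k" c] assms(1) prime_gt_0_nat[OF p]
      by (simp del: power_Suc of_nat_power)
  qed
  then show ?thesis
    by (subst divisor_sigma_eq_prod[OF assms(2)]) (auto simp: prod_zero_iff)
qed

text \<open>
  Multiplying \<open>n\<close> by a large prime \<open>p\<close> changes the value by the nonzero amount \<open>\<sigma>\<^sub>c(n) p\<^sup>c\<close>, which
  tends to zero.
\<close>

lemma divisor_range_no_isolated_points_Re_neg:
  assumes "Re c < 0"
  shows "\<not> z isolated_in divisor_range c"
proof
  assume "z isolated_in divisor_range c"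
  then obtain n e where n: "n > 0" "z = divisor_sigma c n" and e: "e > 0"
    and iso: "\<And>y. y \<in> divisor_range c \<Longrightarrow> dist z y < e \<Longrightarrow> y = z"
    by (auto simp: isolated_in_dist_Ex_iff divisor_range_def)
  have z0: "z \<noteq> 0"
    using divisor_sigma_nonzero n assms by auto
  have "((\<lambda>m. real m powr Re c) \<longlongrightarrow> 0) at_top"
    using assms by real_asymp
  then have "eventually (\<lambda>m. real m powr Re c < e / norm z) at_top"
    using e z0 by (intro order_tendstoD) auto
  then obtain N where N: "\<And>m. m \<ge> N \<Longrightarrow> real m powr Re c < e / norm z"
    by (auto simp: eventually_at_top_linorder)
  obtain p where p: "prime p" "p > max n N"
    using bigger_prime by blast
  have cop: "coprime n p"
    using p n by (metis coprime_commute dvd_imp_le leD max_less_iff_conj prime_imp_coprime)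
  have pk: "divisor_sigma c p = 1 + nat_cpow c p"
    using divisor_sigma_prime_power[OF p(1), of c 1] by simp
  have eq: "divisor_sigma c (n * p) = z + z * nat_cpow c p"
    using cop n p by (simp add: divisor_sigma_mult_coprime pk algebra_simps prime_gt_0_nat)
  have "norm (z * nat_cpow c p) < e"
    using N[of p] p z0 by (simp add: norm_mult norm_nat_cpow prime_gt_0_nat field_simps)
  moreover have "divisor_sigma c (n * p) \<in> divisor_range c"
    using n p by (auto simp: divisor_range_def prime_gt_0_nat intro!: exI[of _ "n * p"])
  ultimately have "z + z * nat_cpow c p = z"
    using iso[of "z + z * nat_cpow c p"] unfolding eq by (simp add: dist_norm)
  then show False using z0 by simp
qed

section \<open>Exponents with positive real part and the exponent zero\<close>

text \<open>
  With \<open>r = p\<^sup>a\<close>, the closed form of the geometric sum gives the lower bound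
  \<open>(r\<^bsup>k+1\<^esup> - 1) / (r + 1) \<ge> r\<^sup>k (r - 1) / (r + 1)\<close>, whose last quotient increases with \<open>r \<ge> 2\<^sup>a\<close>.
\<close>

lemma norm_divisor_sigma_prime_power_ge:
  assumes "Re c > 0" "prime p"
  shows "norm (divisor_sigma c (p ^ k)) \<ge>
    (2 powr Re c - 1) / (2 powr Re c + 1) * real (p ^ k) powr Re c"
proof -
  define a where "a = Re c"
  define r where "r = real p powr a"
  have p2: "real p \<ge> 2" using prime_ge_2_nat[OF assms(2)] by simp
  have r2: "r \<ge> 2 powr a" and two: "2 powr a > (1::real)"
    using p2 assms by (auto simp: r_def a_def intro!: powr_mono2)
  have u: "norm (nat_cpow c p) = r"
    using p2 by (simp add: norm_nat_cpow r_def a_def)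
  have rk: "real (p ^ k) powr a = r ^ k"
    using p2 by (simp add: r_def powr_realpow[symmetric] powr_powr mult.commute)
  have "norm (divisor_sigma c (p ^ k)) * norm (1 - nat_cpow c p) = norm (1 - nat_cpow c p ^ Suc k)"
    by (simp only: norm_mult[symmetric] divisor_sigma_prime_power_mult[OF assms(2)])
  also have "\<dots> \<ge> r ^ Suc k - 1"
    using norm_triangle_ineq2[of "nat_cpow c p ^ Suc k" 1] u
    by (simp add: norm_minus_commute norm_power norm_mult)
  finally have "r ^ Suc k - 1 \<le> norm (divisor_sigma c (p ^ k)) * norm (1 - nat_cpow c p)" .
  also have "\<dots> \<le> norm (divisor_sigma c (p ^ k)) * (r + 1)"
    using norm_triangle_ineq4[of 1 "nat_cpow c p"] u by (intro mult_left_mono) auto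
  finally have *: "r ^ Suc k - 1 \<le> norm (divisor_sigma c (p ^ k)) * (r + 1)" .
  have "(2 powr a - 1) / (2 powr a + 1) \<le> (r - 1) / (r + 1)"
    using r2 two by (simp add: field_simps)
  moreover have "(r - 1) * r ^ k \<le> r ^ Suc k - 1"
    using r2 two one_le_power[of r k] by (simp add: algebra_simps)
  ultimately have "(2 powr a - 1) / (2 powr a + 1) * r ^ k \<le> (r - 1) / (r + 1) * r ^ k"
    using r2 two by (intro mult_right_mono) auto
  also have "\<dots> \<le> norm (divisor_sigma c (p ^ k))"
    using order.trans[OF \<open>(r - 1) * r ^ k \<le> r ^ Suc k - 1\<close> *] r2 two
    by (simp add: pos_divide_le_eq)
  finally show ?thesis
    using rk unfolding a_def by simp
qed

text \<open>
  The factor \<open>\<kappa> < 1\<close> lost at each prime power \<open>q\<close> is compensated by \<open>q\<^bsup>a/2\<^esup>\<close> once \<open>q\<close> is at least some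
  bound \<open>Q\<close>. Only the primes below \<open>Q\<close> contribute a loss, and the product of their
  losses is at least \<open>\<kappa>\<^bsup>Q\<^esup>\<close>.
\<close>

lemma norm_divisor_sigma_ge:
  assumes "Re c > 0"
  obtains K where "K > 0" "\<And>n. n > 0 \<Longrightarrow> norm (divisor_sigma c n) \<ge> K * real n powr (Re c / 2)"
proof -
  define a where "a = Re c"
  have a: "a > 0" using assms by (simp add: a_def)
  define \<kappa> where "\<kappa> = (2 powr a - 1) / (2 powr a + 1)"
  have "2 powr a > (1::real)" using a by simp
  then have \<kappa>: "\<kappa> > 0" "\<kappa> < 1"
    by (auto simp: \<kappa>_def)
  have "filterlim (\<lambda>m. \<kappa> * real m powr (a / 2)) at_top at_top"
    using a \<kappa> by real_asymp
  then have "eventually (\<lambda>m. \<kappa> * real m powr (a / 2) \<ge> 1) at_top"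
    by (simp add: filterlim_at_top)
  then obtain Q where Q: "\<And>m. m \<ge> Q \<Longrightarrow> \<kappa> * real m powr (a / 2) \<ge> 1"
    by (auto simp: eventually_at_top_linorder)
  define g where "g = (\<lambda>p. if p < Q then \<kappa> else 1)"
  have pp: "norm (divisor_sigma c (p ^ k)) \<ge> g p * real (p ^ k) powr (a / 2)"
    if p: "prime p" and k: "k > 0" for p k
  proof -
    define x where "x = real (p ^ k) powr (a / 2)"
    have pk: "p ^ k \<ge> p" "p > 0"
      using p k prime_gt_0_nat[OF p] by (auto intro: self_le_power)
    have x1: "x \<ge> 1"
      unfolding x_def using a pk by (intro ge_one_powr_ge_zero) (auto simp del: of_nat_power)
    have xx: "real (p ^ k) powr a = x * x"
      unfolding x_def by (simp flip: powr_add)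
    have "g p * x \<le> \<kappa> * (x * x)"
    proof (cases "p < Q")
      case True
      then show ?thesis using x1 \<kappa> by (simp add: g_def)
    next
      case False
      then have "\<kappa> * x \<ge> 1" unfolding x_def using pk by (intro Q) auto
      then have "1 * x \<le> (\<kappa> * x) * x" using x1 by (intro mult_right_mono) auto
      then show ?thesis using False by (simp add: g_def mult_ac)
    qed
    also have "\<dots> \<le> norm (divisor_sigma c (p ^ k))"
      using norm_divisor_sigma_prime_power_ge[OF assms p, of k] xx by (simp add: \<kappa>_def a_def)
    finally show ?thesis by (simp add: x_def)
  qed
  show thesis
  proof
    show "\<kappa> ^ Q > 0" using \<kappa> by simp
    fix n :: nat assume n: "n > 0"
    let ?P = "prime_factors n" and ?k = "\<lambda>p. multiplicity p n"
    have gprod: "(\<Prod>p\<in>?P. g p) \<ge> \<kappa> ^ Q"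
    proof -
      have "(\<Prod>p\<in>?P. g p) = (\<Prod>p\<in>?P \<inter> {..<Q}. \<kappa>)"
        unfolding g_def by (subst prod.inter_restrict) (auto intro!: prod.cong)
      also have "\<dots> = \<kappa> ^ card (?P \<inter> {..<Q})" by simp
      also have "\<dots> \<ge> \<kappa> ^ Q"
        using \<kappa> card_mono[of "{..<Q}" "?P \<inter> {..<Q}"] by (intro power_decreasing) auto
      finally show ?thesis .
    qed
    have "real n = (\<Prod>p\<in>?P. real (p ^ ?k p))"
      using n prime_factorization_nat[of n] by (simp flip: of_nat_prod of_nat_power)
    then have npow: "real n powr (a / 2) = (\<Prod>p\<in>?P. real (p ^ ?k p) powr (a / 2))"
      by (simp only:) (subst prod_powr_distrib; simp)
    have "\<kappa> ^ Q * real n powr (a / 2) \<le> (\<Prod>p\<in>?P. g p) * real n powr (a / 2)"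
      using gprod by (intro mult_right_mono) auto
    also have "\<dots> = (\<Prod>p\<in>?P. g p * real (p ^ ?k p) powr (a / 2))"
      by (simp only: npow prod.distrib)
    also have "\<dots> \<le> (\<Prod>p\<in>?P. norm (divisor_sigma c (p ^ ?k p)))"
      using \<kappa> n by (intro prod_mono conjI pp) (auto simp: g_def prime_factors_multiplicity)
    also have "\<dots> = norm (divisor_sigma c n)"
      by (simp add: divisor_sigma_eq_prod[OF n] prod_norm)
    finally show "\<kappa> ^ Q * real n powr (Re c / 2) \<le> norm (divisor_sigma c n)"
      by (simp add: a_def)
  qed
qed

lemma divisor_range_isolated_Re_pos:
  assumes "Re c > 0" "z \<in> divisor_range c"
  shows "z isolated_in divisor_range c"
proof -
  obtain K where K: "K > 0" "\<And>n. n > 0 \<Longrightarrow> norm (divisor_sigma c n) \<ge> K * real n powr (Re c / 2)"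
    using norm_divisor_sigma_ge[OF assms(1)] by blast
  define M where "M = norm z + 1"
  have "filterlim (\<lambda>m. K * real m powr (Re c / 2)) at_top at_top"
    using K assms by real_asymp
  then have "eventually (\<lambda>m. K * real m powr (Re c / 2) > M) at_top"
    by (simp add: filterlim_at_top_dense)
  then obtain N where N: "\<And>m. m \<ge> N \<Longrightarrow> K * real m powr (Re c / 2) > M"
    by (auto simp: eventually_at_top_linorder)
  have "divisor_range c \<inter> ball z 1 \<subseteq> divisor_sigma c ` {..<N}"
  proof safe
    fix y assume y: "y \<in> divisor_range c" "y \<in> ball z 1"
    then obtain n where n: "n > 0" "y = divisor_sigma c n"
      by (auto simp: divisor_range_def)
    have "norm y \<le> M"
      using y(2) norm_triangle_ineq2[of y z] by (simp add: M_def dist_norm norm_minus_commute)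
    then have "n < N"
      using N[of n] K(2)[of n] n by (smt (verit) linorder_not_le)
    then show "y \<in> divisor_sigma c ` {..<N}" using n by auto
  qed
  then have "finite (divisor_range c \<inter> ball z 1)"
    by (rule finite_subset) simp
  then have "\<not> z islimpt divisor_range c"
    by (auto simp: islimpt_eq_infinite_ball intro!: exI[of _ 1])
  then show ?thesis
    using assms by (simp add: isolated_in_islimpt_iff)
qed

lemma divisor_range_isolated_0:
  assumes "z \<in> divisor_range 0"
  shows "z isolated_in divisor_range 0"
proof -
  have nat: "\<exists>k. y = of_nat k" if "y \<in> divisor_range 0" for y
    using that by (auto simp: divisor_range_def divisor_sigma_def)
  have "y = z" if "y \<in> divisor_range 0" "dist z y < 1" for y
  proof -
    obtain j k where jk: "y = of_nat j" "z = of_nat k"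
      using nat[OF \<open>y \<in> divisor_range 0\<close>] nat[OF assms] by blast
    have "dist z y = \<bar>real k - real j\<bar>"
      unfolding jk dist_norm by (metis norm_of_real of_real_diff of_real_of_nat_eq)
    then show ?thesis
      using that jk by auto
  qed
  then show ?thesis
    using assms by (auto simp: isolated_in_dist_Ex_iff intro!: exI[of _ 1])
qed

section \<open>The oscillation of \<open>p\<^bsup>it\<^esup>\<close> along the primes\<close>

text \<open>
  What remains of the positive integers after sieving by the primes in \<open>F\<close>; summing over this set
  avoids convergence questions for the infinite Euler product.
\<close>

definition coprime_to_all :: "nat set \<Rightarrow> nat set" where
  "coprime_to_all F = {n. n > 0 \<and> (\<forall>p\<in>F. \<not> p dvd n)}"

text \<open>
  A finite Euler product, obtained by sieving: removing the multiples of one more prime \<open>p\<close> from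
  the summation range subtracts \<open>f p\<close> times the sum over that range.
\<close>

lemma infsum_coprime_to_all:
  fixes f :: "nat \<Rightarrow> 'a :: {banach, real_normed_field}"
  assumes "f summable_on {0<..}" "\<And>m n. m > 0 \<Longrightarrow> n > 0 \<Longrightarrow> f (m * n) = f m * f n"
    and "finite F" "\<And>p. p \<in> F \<Longrightarrow> prime p"
  shows "infsum f (coprime_to_all F) = infsum f {0<..} * (\<Prod>p\<in>F. 1 - f p)"
  using assms(3,4)
proof (induction F rule: finite_induct)
  case empty
  have "coprime_to_all {} = {0<..}" by (auto simp: coprime_to_all_def)
  then show ?case by simp
next
  case (insert p F)
  let ?A = "coprime_to_all F" and ?B = "coprime_to_all (insert p F)"
  have p: "prime p" "p > 0" using insert.prems prime_gt_0_nat by auto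
  have eq: "?A = ?B \<union> (\<lambda>n. p * n) ` ?A"
  proof (intro equalityI subsetI)
    fix n assume n: "n \<in> ?A"
    show "n \<in> ?B \<union> (\<lambda>n. p * n) ` ?A"
    proof (cases "p dvd n")
      case True
      then obtain m where "n = p * m" by blast
      then show ?thesis using n by (auto simp: coprime_to_all_def intro!: imageI)
    qed (use n in \<open>auto simp: coprime_to_all_def\<close>)
  next
    fix n assume "n \<in> ?B \<union> (\<lambda>n. p * n) ` ?A"
    then consider "n \<in> ?B" | m where "n = p * m" "m \<in> ?A" by blast
    then show "n \<in> ?A"
    proof cases
      case (2 m)
      have "\<not> q dvd p * m" if "q \<in> F" for q
        using that insert 2 p
        by (metis (no_types, lifting) coprime_to_all_def insertCI mem_Collect_eq prime_dvd_mult_iff primes_dvd_imp_eq)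
      then show ?thesis using 2 p by (auto simp: coprime_to_all_def)
    qed (auto simp: coprime_to_all_def)
  qed
  have disj: "?B \<inter> (\<lambda>n. p * n) ` ?A = {}"
    by (auto simp: coprime_to_all_def)
  have sub: "?A \<subseteq> {0<..}" "?B \<subseteq> {0<..}" "(\<lambda>n. p * n) ` ?A \<subseteq> {0<..}"
    using p by (auto simp: coprime_to_all_def)
  have "infsum f ?A = infsum f (?B \<union> (\<lambda>n. p * n) ` ?A)"
    using eq by simp
  also have "\<dots> = infsum f ?B + infsum f ((\<lambda>n. p * n) ` ?A)"
    by (intro infsum_Un_disjoint disj summable_on_subset_banach[OF assms(1)] sub)
  also have "infsum f ((\<lambda>n. p * n) ` ?A) = infsum (\<lambda>n. f p * f n) ?A"
  proof (subst infsum_reindex)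
    show "inj_on (\<lambda>n. p * n) ?A" using p by (simp add: inj_on_def)
    show "infsum (f \<circ> (\<lambda>n. p * n)) ?A = infsum (\<lambda>n. f p * f n) ?A"
      using assms(2) p(2) sub(1) by (intro infsum_cong) auto
  qed
  also have "\<dots> = f p * infsum f ?A"
    by (rule infsum_cmult_right')
  finally have "infsum f ?B = infsum f ?A - f p * infsum f ?A"
    by (metis add_diff_cancel_right')
  then have "infsum f ?B = infsum f ?A * (1 - f p)"
    by (simp add: algebra_simps)
  then show ?case
    using insert by (simp add: mult_ac)
qed

lemma nat_cpow_summable_on:
  assumes "Re s > 1"
  shows "(\<lambda>n. real n powr - Re s) summable_on {0<..}" "nat_cpow (-s) summable_on {0<..}"
proof -
  have rng: "{0<..} = range Suc"
    by (auto simp: image_iff gr0_conv_Suc)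
  have 1: "summable (\<lambda>n. norm (real (Suc n) powr - Re s))"
    using summable_real_powr_iff[of "- Re s"] assms by (simp add: summable_Suc_iff[of "\<lambda>n. real n powr - Re s"] del: of_nat_Suc)
  have 2: "summable (\<lambda>n. norm (nat_cpow (-s) (Suc n)))"
    using 1 by (simp add: norm_nat_cpow del: of_nat_Suc)
  show "(\<lambda>n. real n powr - Re s) summable_on {0<..}"
    unfolding rng using norm_summable_imp_summable_on[OF 1]
    by (subst summable_on_reindex) (simp_all add: o_def del: of_nat_Suc)
  show "nat_cpow (-s) summable_on {0<..}"
    unfolding rng using norm_summable_imp_summable_on[OF 2]
    by (subst summable_on_reindex) (simp_all add: o_def)
qed

lemma sums_infsum_Suc:
  fixes f :: "nat \<Rightarrow> 'a :: banach"
  assumes "f summable_on {0<..}"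
  shows "(\<lambda>n. f (Suc n)) sums infsum f {0<..}"
proof -
  have rng: "{0<..} = range Suc"
    by (auto simp: image_iff gr0_conv_Suc)
  have "(f has_sum infsum f {0<..}) (range Suc)"
    using assms unfolding rng by (rule has_sum_infsum)
  then show ?thesis
    by (intro has_sum_imp_sums) (simp add: has_sum_reindex o_def)
qed

text \<open>
  First-order Taylor expansion of the antiderivative \<open>x\<^bsup>1-s\<^esup> / (1 - s)\<close> of \<open>x\<^bsup>-s\<^esup>\<close>. It compares the
  Dirichlet series of \<open>\<zeta>\<close> with a telescoping series, up to an error summable uniformly near the
  line \<open>Re s = 1\<close>.
\<close>

lemma nat_cpow_telescope_bound:
  assumes "Re s \<ge> 1" "s \<noteq> 1" "n > 0"
  shows "norm (nat_cpow (1 - s) (Suc n) / (1 - s) - nat_cpow (1 - s) n / (1 - s) - nat_cpow (-s) n)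
           \<le> norm s / real n ^ 2"
proof -
  have powr: "nat_cpow w m = of_nat m powr w" if "m > 0" for w m
    using that by (simp add: nat_cpow_def powr_def Ln_of_nat)
  define f where "f = (\<lambda>(i::nat) z. if i = 0 then z powr (1 - s) / (1 - s)
      else if i = 1 then z powr (-s) else - s * z powr (- s - 1) :: complex)"
  define S where "S = closed_segment (complex_of_real (real n)) (complex_of_real (real (Suc n)))"
  have S: "\<exists>r. x = complex_of_real r \<and> r \<ge> real n" if "x \<in> S" for x
    using that unfolding S_def closed_segment_of_real by (auto simp: closed_segment_eq_real_ivl)
  have nz: "x \<notin> \<real>\<^sub>\<le>\<^sub>0" if "x \<in> S" for x
    using S[OF that] assms(3) by (auto simp: complex_nonpos_Reals_iff)
  have "norm (f 0 (of_nat (Suc n)) - (\<Sum>i\<le>1. f i (of_nat n) * (of_nat (Suc n) - of_nat n) ^ i / fact i))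
        \<le> norm s / real n ^ 2 * norm (complex_of_nat (Suc n) - of_nat n) ^ Suc 1 / fact 1"
  proof (rule complex_Taylor)
    show "convex S" by (simp add: S_def)
    show "of_nat n \<in> S" "of_nat (Suc n) \<in> S" by (simp_all add: S_def)
    fix i :: nat and x assume x: "x \<in> S" and i: "i \<le> 1"
    then consider "i = 0" | "i = 1" by linarith
    then show "(f i has_field_derivative f (Suc i) x) (at x within S)"
    proof cases
      case 1
      have "((\<lambda>z. z powr (1 - s) / (1 - s)) has_field_derivative x powr (-s)) (at x)"
        using nz[OF x] assms(2) by (auto intro!: derivative_eq_intros)
      then show ?thesis using 1 by (simp add: f_def has_field_derivative_at_within)
    next
      case 2
      have "((\<lambda>z. z powr (- s)) has_field_derivative - s * x powr (-s - 1)) (at x)"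
        using nz[OF x] by (auto intro!: derivative_eq_intros)
      then show ?thesis using 2 by (simp add: f_def has_field_derivative_at_within)
    qed
  next
    fix x assume "x \<in> S"
    then obtain r where r: "x = complex_of_real r" "r \<ge> real n" using S by blast
    have rpos: "r > 0" using r assms(3) by (smt (verit) of_nat_0_less_iff)
    have "norm (x powr (- s - 1)) = r powr (- Re s - 1)"
      using rpos r by (simp add: norm_powr_real_powr)
    also have "\<dots> \<le> r powr (- 2)"
      using assms r by (intro powr_mono) (auto intro: order.trans[of 1 "real n" r])
    also have "\<dots> \<le> real n powr (-2)"
      using assms r by (intro powr_mono2') auto
    also have "\<dots> = 1 / real n ^ 2"
      using assms by (simp add: powr_minus field_simps)
    finally show "norm (f (Suc 1) x) \<le> norm s / real n ^ 2"
      by (simp add: f_def norm_mult) (metis mult_left_mono norm_ge_zero times_divide_eq_right mult.right_neutral)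
  qed
  then show ?thesis
    using assms(3) by (simp add: f_def powr algebra_simps)
qed

text \<open>
  The telescoping part is at most \<open>2 / \<bar>1 - s\<bar> \<le> 2 / \<bar>t\<bar>\<close>, since \<open>\<bar>n\<^bsup>1-s\<^esup>\<bar> \<le> 1\<close>; so the bound for
  partial sums does not depend on \<open>\<sigma>\<close>.
\<close>

lemma zeta_bounded_right_of_line:
  fixes t :: real
  assumes "t \<noteq> 0"
  obtains C where "\<And>\<sigma>. 1 < \<sigma> \<Longrightarrow> \<sigma> \<le> 2 \<Longrightarrow>
    norm (infsum (nat_cpow (- Complex \<sigma> t)) {0<..}) \<le> C"
proof
  define K where "K = (\<Sum>n. 1 / real (Suc n) ^ 2)"
  fix \<sigma> :: real assume \<sigma>: "1 < \<sigma>" "\<sigma> \<le> 2"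
  define s where "s = Complex \<sigma> t"
  have s: "Re s = \<sigma>" "s \<noteq> 1" and ts: "norm (1 - s) \<ge> \<bar>t\<bar>"
    using \<sigma> abs_Im_le_cmod[of "1 - s"] by (auto simp: s_def complex_eq_iff)
  have ns: "norm s \<le> 2 + \<bar>t\<bar>"
    using cmod_le[of s] \<sigma> by (simp add: s_def)
  define G where "G = (\<lambda>n. nat_cpow (1 - s) (Suc n) / (1 - s))"
  have G: "norm (G n) \<le> 1 / \<bar>t\<bar>" for n
  proof -
    have "norm (nat_cpow (1 - s) (Suc n)) \<le> 1"
      using \<sigma> s powr_mono[of "1 - \<sigma>" 0 "real (Suc n)"] by (simp add: norm_nat_cpow)
    then show ?thesis
      unfolding G_def norm_divide using ts assms by (intro frac_le) auto
  qed
  have summ: "summable (\<lambda>n. 1 / real (Suc n) ^ 2)"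
    using inverse_power_summable[of 2, where 'a = real]
    by (subst summable_Suc_iff[of "\<lambda>n. 1 / real n ^ 2"]) (simp add: divide_inverse)
  have part: "norm (\<Sum>i<N. nat_cpow (-s) (Suc i)) \<le> 2 / \<bar>t\<bar> + (2 + \<bar>t\<bar>) * K" for N
  proof -
    have "(\<Sum>i<N. nat_cpow (-s) (Suc i)) =
        (\<Sum>i<N. G (Suc i) - G i) - (\<Sum>i<N. G (Suc i) - G i - nat_cpow (-s) (Suc i))"
      by (simp add: sum_subtractf)
    also have "(\<Sum>i<N. G (Suc i) - G i) = G N - G 0"
      by (rule sum_lessThan_telescope)
    finally have "norm (\<Sum>i<N. nat_cpow (-s) (Suc i)) \<le>
        norm (G N - G 0) + norm (\<Sum>i<N. G (Suc i) - G i - nat_cpow (-s) (Suc i))"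
      by (simp only:) (rule norm_triangle_ineq4)
    also have "norm (G N - G 0) \<le> 2 / \<bar>t\<bar>"
      using norm_triangle_ineq4[of "G N" "G 0"] G[of N] G[of 0] by simp
    also have "norm (\<Sum>i<N. G (Suc i) - G i - nat_cpow (-s) (Suc i))
        \<le> (\<Sum>i<N. (2 + \<bar>t\<bar>) * (1 / real (Suc i) ^ 2))"
    proof (rule sum_norm_le)
      fix i
      have "norm (G (Suc i) - G i - nat_cpow (-s) (Suc i)) \<le> norm s / real (Suc i) ^ 2"
        unfolding G_def using \<sigma> s by (intro nat_cpow_telescope_bound) auto
      also have "\<dots> \<le> (2 + \<bar>t\<bar>) / real (Suc i) ^ 2"
        using ns by (intro divide_right_mono) auto
      finally show "norm (G (Suc i) - G i - nat_cpow (-s) (Suc i)) \<le> (2 + \<bar>t\<bar>) * (1 / real (Suc i) ^ 2)"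
        by simp
    qed
    also have "\<dots> = (2 + \<bar>t\<bar>) * (\<Sum>i<N. 1 / real (Suc i) ^ 2)"
      by (simp add: sum_distrib_left)
    also have "\<dots> \<le> (2 + \<bar>t\<bar>) * K"
      unfolding K_def using summ by (intro mult_left_mono sum_le_suminf) auto
    finally show ?thesis by simp
  qed
  have "(\<lambda>N. \<Sum>i<N. nat_cpow (-s) (Suc i)) \<longlonglongrightarrow> infsum (nat_cpow (-s)) {0<..}"
    using sums_infsum_Suc[OF nat_cpow_summable_on(2)[of s]] \<sigma> s by (simp add: sums_def)
  then show "norm (infsum (nat_cpow (- Complex \<sigma> t)) {0<..}) \<le> 2 / \<bar>t\<bar> + (2 + \<bar>t\<bar>) * K"
    unfolding s_def[symmetric]
    by (rule Lim_norm_ubound[rotated]) (use part in auto)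
qed

text \<open>
  A uniform bound would pass to the limit in each partial sum and bound the harmonic series.
\<close>

lemma zeta_unbounded_near_1:
  obtains \<sigma> :: real where "1 < \<sigma>" "\<sigma> \<le> 2" "infsum (\<lambda>n. real n powr - \<sigma>) {0<..} > M"
proof -
  have False if le: "\<And>\<sigma>. 1 < \<sigma> \<Longrightarrow> \<sigma> \<le> 2 \<Longrightarrow> infsum (\<lambda>n. real n powr - \<sigma>) {0<..} \<le> M"
  proof -
    have "(\<Sum>i<N. inverse (real (Suc i))) \<le> M" for N
    proof (rule tendsto_upperbound)
      show "((\<lambda>\<sigma>. \<Sum>i<N. real (Suc i) powr - \<sigma>) \<longlongrightarrow> (\<Sum>i<N. inverse (real (Suc i)))) (at_right 1)"
        by (auto intro!: tendsto_eq_intros sum.cong simp: powr_minus simp del: of_nat_Suc)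
      have "(\<Sum>i<N. real (Suc i) powr - \<sigma>) \<le> M" if "1 < \<sigma>" "\<sigma> < 2" for \<sigma>
      proof -
        have "(\<lambda>n. real (Suc n) powr - \<sigma>) sums infsum (\<lambda>n. real n powr - \<sigma>) {0<..}"
          using sums_infsum_Suc[OF nat_cpow_summable_on(1)[of "of_real \<sigma>"]] that by simp
        then have "(\<Sum>i<N. real (Suc i) powr - \<sigma>) \<le> infsum (\<lambda>n. real n powr - \<sigma>) {0<..}"
          by (intro sum_le_suminf[of _ "{..<N}", THEN order.trans]) (auto simp: sums_iff)
        then show ?thesis using le[of \<sigma>] that by simp
      qed
      then show "eventually (\<lambda>\<sigma>. (\<Sum>i<N. real (Suc i) powr - \<sigma>) \<le> M) (at_right 1)"
        by (auto simp: eventually_at_right_field intro!: exI[of _ 2])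
    qed auto
    then have "summable (\<lambda>i. inverse (real (Suc i)))"
      by (intro summableI_nonneg_bounded) auto
    then show False
      using not_summable_harmonic[where 'a = real] summable_Suc_iff[of "\<lambda>n. inverse (real n)"]
      by simp
  qed
  then show thesis using that by (meson not_le)
qed

text \<open>
  Suppose that \<open>cos (t ln p) \<ge> 3/4\<close> for all primes outside a finite set \<open>E\<close>. With \<open>q = p\<^bsup>-\<sigma>\<^esup> \<le> 1/2\<close> and
  \<open>s = \<sigma> + i t\<close>, such a prime satisfies
  \<open>\<bar>1 - p\<^bsup>-s\<^esup>\<bar>\<^sup>2 = 1 - 2 q cos (t ln p) + q\<^sup>2 \<le> 1 - 3q/2 + q/2 = 1 - q\<close>,
  and a prime in \<open>E\<close> satisfies the same up to a factor \<open>8\<close>. Multiplying over primes bounds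
  \<open>\<zeta>(\<sigma>)\<close> by \<open>8 \<cdot> 8\<^bsup>card E\<^esup> \<bar>\<zeta>(s)\<bar>\<^sup>2\<close>, the first \<open>8\<close> coming from truncating the Euler products.
  Near \<open>\<sigma> = 1\<close> this contradicts the two preceding lemmas.
\<close>

lemma infinite_primes_cos_less:
  fixes t :: real
  assumes "t \<noteq> 0"
  shows "infinite {p. prime p \<and> cos (t * ln (real p)) < 3 / 4}"
proof
  assume fin: "finite {p. prime p \<and> cos (t * ln (real p)) < 3 / 4}"
  define E where "E = {p::nat. prime p \<and> cos (t * ln (real p)) < 3 / 4}"
  obtain C where C: "\<And>\<sigma>. 1 < \<sigma> \<Longrightarrow> \<sigma> \<le> 2 \<Longrightarrow>
      norm (infsum (nat_cpow (- Complex \<sigma> t)) {0<..}) \<le> C"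
    using zeta_bounded_right_of_line[OF assms] by blast
  obtain \<sigma> where \<sigma>: "1 < \<sigma>" "\<sigma> \<le> 2"
    and big: "infsum (\<lambda>n. real n powr - \<sigma>) {0<..} > 8 * 8 ^ card E * C\<^sup>2"
    using zeta_unbounded_near_1 by blast
  define s where "s = Complex \<sigma> t"
  define f where "f = nat_cpow (- s)"
  define q where "q = (\<lambda>n. real n powr - \<sigma>)"
  have Re_s: "Re s = \<sigma>" by (simp add: s_def)
  have summ: "q summable_on {0<..}" "f summable_on {0<..}"
    using nat_cpow_summable_on[of s] \<sigma> unfolding f_def q_def Re_s by auto
  have q_nonneg: "q n \<ge> 0" for n by (simp add: q_def)
  have nf: "norm (f n) = q n" if "n > 0" for n
    using that by (simp add: f_def q_def norm_nat_cpow Re_s)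
  \<comment> \<open>truncation: sieving by all primes up to \<open>N\<close> leaves \<open>1\<close> and a part of the tail beyond \<open>N\<close>\<close>
  obtain X where X: "finite X" "X \<subseteq> {0<..}"
    and Xd: "\<And>Y. finite Y \<Longrightarrow> X \<subseteq> Y \<Longrightarrow> Y \<subseteq> {0<..} \<Longrightarrow> dist (sum q Y) (infsum q {0<..}) < 1 / 2"
    using tendstoD[OF infsum_tendsto[OF summ(1)], of "1 / 2"]
    unfolding eventually_finite_subsets_at_top by (metis half_gt_zero_iff zero_less_one)
  obtain N where N: "X \<subseteq> {..N}"
    using X(1) finite_nat_iff_bounded_le by blast
  have tail: "infsum q {N<..} \<le> 1 / 2"
  proof -
    have "{0<..} = {0<..N} \<union> {N<..}" by auto
    then have "infsum q {0<..} = infsum q ({0<..N} \<union> {N<..})" by simp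
    also have "\<dots> = infsum q {0<..N} + infsum q {N<..}"
      by (intro infsum_Un_disjoint summable_on_subset_banach[OF summ(1)]) auto
    finally have "infsum q {0<..} = sum q {0<..N} + infsum q {N<..}" by simp
    moreover have "dist (sum q {0<..N}) (infsum q {0<..}) < 1 / 2"
      using N X by (intro Xd) auto
    ultimately show ?thesis by (simp add: dist_real_def)
  qed
  define F where "F = {p. prime p \<and> p \<le> N}"
  have F: "finite F" "\<And>p. p \<in> F \<Longrightarrow> prime p" by (auto simp: F_def)
  let ?R = "coprime_to_all F"
  have R_sub: "?R - {1} \<subseteq> {N<..}"
  proof
    fix n assume n: "n \<in> ?R - {1}"
    then obtain p where p: "prime p" "p dvd n"
      using prime_factor_nat[of n] by blast
    then have "p > N" using n by (auto simp: coprime_to_all_def F_def)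
    moreover have "p \<le> n" using p n by (auto simp: coprime_to_all_def intro: dvd_imp_le)
    ultimately show "n \<in> {N<..}" by simp
  qed
  have "1 \<notin> F" using F(2) not_prime_1 by blast
  then have R1: "1 \<in> ?R" by (auto simp: coprime_to_all_def)
  have R_pos: "?R \<subseteq> {0<..}" by (auto simp: coprime_to_all_def)
  have rest: "infsum q (?R - {1}) \<le> 1 / 2"
  proof -
    have "infsum q (?R - {1}) \<le> infsum q {N<..}"
      using R_sub R_pos q_nonneg by (intro infsum_mono2 summable_on_subset_banach[OF summ(1)]) auto
    then show ?thesis using tail by simp
  qed
  have split: "infsum g ?R = g 1 + infsum g (?R - {1})" if "g summable_on {0<..}"
    for g :: "nat \<Rightarrow> 'b :: banach"
  proof -
    have "infsum g ({1} \<union> (?R - {1})) = infsum g {1} + infsum g (?R - {1})"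
      using R1 R_pos by (intro infsum_Un_disjoint summable_on_subset_banach[OF that]) auto
    moreover have "{1} \<union> (?R - {1}) = ?R" using R1 by auto
    ultimately show ?thesis by simp
  qed
  have "norm (infsum f (?R - {1})) \<le> infsum q (?R - {1})"
    using R_pos nf
    by (intro norm_infsum_le[OF has_sum_infsum has_sum_infsum]
        summable_on_subset_banach[OF summ(1)] summable_on_subset_banach[OF summ(2)]) auto
  then have "1 / 2 \<le> norm (infsum f ?R)"
    using rest norm_triangle_ineq2[of 1 "- infsum f (?R - {1})"] split[OF summ(2)] by (simp add: f_def)
  also have fR: "infsum f ?R = infsum f {0<..} * (\<Prod>p\<in>F. 1 - f p)"
    using F summ by (intro infsum_coprime_to_all) (auto simp: f_def nat_cpow_mult)
  finally have lower: "1 / 2 \<le> norm (infsum f {0<..}) * (\<Prod>p\<in>F. norm (1 - f p))"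
    by (simp add: norm_mult prod_norm)
  have qR: "infsum q ?R = infsum q {0<..} * (\<Prod>p\<in>F. 1 - q p)"
    using F summ by (intro infsum_coprime_to_all) (auto simp: q_def powr_mult)
  have qR2: "infsum q ?R \<le> 2"
    using split[OF summ(1)] rest by (simp add: q_def)
  have factor: "(norm (1 - f p))\<^sup>2 \<le> (if p \<in> E then 8 else 1) * (1 - q p)" "1 - q p \<ge> 0" if "p \<in> F" for p
  proof -
    have p: "prime p" "real p \<ge> 2" using that F prime_ge_2_nat by (auto simp: of_nat_le_iff[of 2, simplified])
    have "q p \<le> real p powr - 1"
      unfolding q_def using p \<sigma> by (intro powr_mono) auto
    also have "\<dots> \<le> 1 / 2" using p by (simp add: powr_minus field_simps)
    finally have q: "q p \<le> 1 / 2" .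
    then show "1 - q p \<ge> 0" by simp
    have Re_f: "Re (f p) = q p * cos (t * ln (real p))"
      using p by (simp add: f_def nat_cpow_def s_def q_def Re_exp powr_def mult.commute)
    have "(norm (1 - f p))\<^sup>2 = 1 - 2 * Re (f p) + (norm (f p))\<^sup>2"
      unfolding cmod_power2 by (simp add: power2_eq_square algebra_simps)
    also have "\<dots> = 1 - 2 * q p * cos (t * ln (real p)) + (q p)\<^sup>2"
      using nf[of p] p by (simp add: Re_f)
    finally have eq: "(norm (1 - f p))\<^sup>2 = 1 - 2 * q p * cos (t * ln (real p)) + (q p)\<^sup>2" .
    have qq: "(q p)\<^sup>2 \<le> q p / 2"
      using mult_left_mono[OF q q_nonneg[of p]] by (simp add: power2_eq_square)
    show "(norm (1 - f p))\<^sup>2 \<le> (if p \<in> E then 8 else 1) * (1 - q p)"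
    proof (cases "p \<in> E")
      case True
      \<comment> \<open>here \<open>\<bar>1 - f p\<bar>\<^sup>2 \<le> 1 + 2 q p + q p / 2 \<le> 9/4\<close>, while \<open>8 (1 - q p) \<ge> 4\<close>\<close>
      have "- q p \<le> q p * cos (t * ln (real p))"
        using mult_left_mono[OF cos_ge_minus_one q_nonneg[of p]] by simp
      then show ?thesis using True q qq unfolding eq by simp
    next
      case False
      then have "cos (t * ln (real p)) \<ge> 3 / 4" using p by (auto simp: E_def)
      then have "q p * (3 / 4) \<le> q p * cos (t * ln (real p))"
        using q_nonneg by (rule mult_left_mono)
      then show ?thesis using False q qq unfolding eq by simp
    qed
  qed
  have "(\<Prod>p\<in>F. norm (1 - f p))\<^sup>2 \<le> (\<Prod>p\<in>F. (if p \<in> E then 8 else 1) * (1 - q p))"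
    unfolding prod_power_distrib using factor by (intro prod_mono) auto
  also have "\<dots> = (\<Prod>p\<in>F. if p \<in> E then 8 else 1) * (\<Prod>p\<in>F. 1 - q p)"
    by (rule prod.distrib)
  also have "(\<Prod>p\<in>F. if p \<in> E then 8 else (1::real)) = 8 ^ card (F \<inter> E)"
    using F(1) by (simp add: prod.inter_restrict[symmetric])
  also have "8 ^ card (F \<inter> E) * (\<Prod>p\<in>F. 1 - q p) \<le> 8 ^ card E * (\<Prod>p\<in>F. 1 - q p)"
    using fin factor(2) by (intro mult_right_mono power_increasing card_mono prod_nonneg) (auto simp: E_def)
  finally have prod_le: "(\<Prod>p\<in>F. norm (1 - f p))\<^sup>2 \<le> 8 ^ card E * (\<Prod>p\<in>F. 1 - q p)" .
  define Z where "Z = infsum q {0<..}"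
  have "Z > 8 * 8 ^ card E * C\<^sup>2" using big by (simp add: Z_def q_def)
  then have Zpos: "Z > 0"
    by (meson le_less_trans mult_nonneg_nonneg zero_le_numeral zero_le_power zero_le_power2)
  have "1 / 4 \<le> (norm (infsum f {0<..}) * (\<Prod>p\<in>F. norm (1 - f p)))\<^sup>2"
    using power_mono[OF lower, of 2] by (simp add: power2_eq_square)
  also have "\<dots> = (norm (infsum f {0<..}))\<^sup>2 * (\<Prod>p\<in>F. norm (1 - f p))\<^sup>2"
    by (rule power_mult_distrib)
  also have "\<dots> \<le> C\<^sup>2 * (8 ^ card E * (\<Prod>p\<in>F. 1 - q p))"
    using C[OF \<sigma>] prod_le by (intro mult_mono power_mono) (auto simp: f_def s_def)
  finally have "Z / 4 \<le> Z * (C\<^sup>2 * (8 ^ card E * (\<Prod>p\<in>F. 1 - q p)))"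
    using mult_left_mono[of "1 / 4" _ Z] Zpos by fastforce
  also have "\<dots> = C\<^sup>2 * 8 ^ card E * infsum q ?R"
    by (simp add: qR Z_def mult_ac)
  also have "\<dots> \<le> C\<^sup>2 * 8 ^ card E * 2"
    using qR2 by (intro mult_left_mono) auto
  finally show False
    using \<open>Z > 8 * 8 ^ card E * C\<^sup>2\<close> by (simp add: mult_ac)
qed

section \<open>Density of products\<close>

lemma closure_mult:
  fixes x y :: "'a :: real_normed_algebra"
  assumes "x \<in> closure X" "y \<in> closure Y"
  shows "x * y \<in> closure {a * b | a b. a \<in> X \<and> b \<in> Y}"
proof -
  have "(\<lambda>(a, b). a * b) ` closure (X \<times> Y) \<subseteq> closure ((\<lambda>(a, b). a * b) ` (X \<times> Y))"
    by (intro image_closure_subset closure_subset)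
       (auto simp: case_prod_unfold intro!: continuous_intros)
  moreover have "(\<lambda>(a, b). a * b) ` (X \<times> Y) = {a * b | a b. a \<in> X \<and> b \<in> Y}"
    by auto
  ultimately show ?thesis
    using assms by (auto simp: closure_Times)
qed

lemma prod_mem_closure:
  fixes z :: "'i \<Rightarrow> 'a :: {real_normed_field}"
  assumes "finite F" "\<And>i. i \<in> F \<Longrightarrow> z i \<in> closure (range (g i))"
  shows "(\<Prod>i\<in>F. z i) \<in> closure {\<Prod>i\<in>F. g i (k i) | k. True}"
  using assms
proof (induction F rule: finite_induct)
  case (insert i F)
  have "z i * (\<Prod>i\<in>F. z i) \<in>
      closure {a * b | a b. a \<in> range (g i) \<and> b \<in> {\<Prod>i\<in>F. g i (k i) | k. True}}"
    using insert by (intro closure_mult) auto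
  moreover have "{a * b | a b. a \<in> range (g i) \<and> b \<in> {\<Prod>i\<in>F. g i (k i) | k. True}}
      \<subseteq> {\<Prod>i\<in>insert i F. g i (k i) | k. True}"
  proof clarify
    fix j and k :: "'i \<Rightarrow> 'b"
    have "g i j * (\<Prod>i\<in>F. g i (k i)) = (\<Prod>l\<in>insert i F. g l ((k(i := j)) l))"
      using insert.hyps by (auto intro!: prod.cong)
    then show "\<exists>k'. g i j * (\<Prod>i\<in>F. g i (k i)) = (\<Prod>l\<in>insert i F. g l (k' l)) \<and> True"
      by blast
  qed
  ultimately have "z i * (\<Prod>i\<in>F. z i) \<in> closure {\<Prod>i\<in>insert i F. g i (k i) | k. True}"
    using closure_mono by blast
  then show ?case
    using insert.hyps by simp
qed simp

lemma powers_dense_in_unit_circle: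
  fixes \<theta> :: real and v :: complex
  assumes "\<theta> \<notin> \<rat>" "norm v = 1"
  shows "v \<in> closure (range (\<lambda>k. cis (2 * pi * \<theta>) ^ Suc k))"
proof -
  obtain \<alpha> where \<alpha>: "0 \<le> \<alpha>" "\<alpha> \<le> 1" "v = cis (2 * pi * \<alpha>)"
  proof
    show "0 \<le> Arg2pi v / (2 * pi)" "Arg2pi v / (2 * pi) \<le> 1"
      using Arg2pi_ge_0[of v] Arg2pi_lt_2pi[of v] by (auto simp: field_simps)
    show "v = cis (2 * pi * (Arg2pi v / (2 * pi)))"
      using Arg2pi_eq[of v] assms(2) by (simp add: cis_conv_exp mult.commute)
  qed
  have "\<alpha> \<in> closure (range (\<lambda>k. frac (real (Suc k) * \<theta>)))"
    unfolding closure_approachable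
  proof (intro allI impI)
    fix e :: real assume "e > 0"
    then obtain k where "k > 0" "\<bar>frac (real k * \<theta>) - \<alpha>\<bar> < e"
      using Kronecker_approx_1_explicit[OF assms(1) \<alpha>(1,2)] by blast
    then show "\<exists>y\<in>range (\<lambda>k. frac (real (Suc k) * \<theta>)). dist y \<alpha> < e"
      by (intro bexI[of _ "frac (real (Suc (k - 1)) * \<theta>)"] rangeI) (simp add: dist_real_def)
  qed
  moreover have "(\<lambda>x. cis (2 * pi * x)) ` closure (range (\<lambda>k. frac (real (Suc k) * \<theta>)))
      \<subseteq> closure ((\<lambda>x. cis (2 * pi * x)) ` range (\<lambda>k. frac (real (Suc k) * \<theta>)))"
    by (intro image_closure_subset closure_subset) (auto intro!: continuous_intros)
  ultimately have "v \<in> closure ((\<lambda>x. cis (2 * pi * x)) ` range (\<lambda>k. frac (real (Suc k) * \<theta>)))"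
    using \<alpha>(3) by blast
  moreover have "cis (2 * pi * frac (real (Suc k) * \<theta>)) = cis (2 * pi * \<theta>) ^ Suc k" for k
  proof -
    have "2 * pi * frac (real (Suc k) * \<theta>) = real (Suc k) * (2 * pi * \<theta>) - 2 * pi * of_int \<lfloor>real (Suc k) * \<theta>\<rfloor>"
      by (simp add: frac_def algebra_simps)
    also have "cis \<dots> = cis (real (Suc k) * (2 * pi * \<theta>)) / cis (2 * pi * of_int \<lfloor>real (Suc k) * \<theta>\<rfloor>)"
      by (rule cis_divide[symmetric])
    also have "cis (2 * pi * of_int \<lfloor>real (Suc k) * \<theta>\<rfloor>) = 1"
      by (rule cis_multiple_2pi) simp
    finally show ?thesis by (simp only: Complex.DeMoivre div_by_1)
  qed
  ultimately show ?thesis by (simp add: image_image)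
qed

text \<open>
  The powers of \<open>u\<close> approach every point \<open>v\<close> of the unit circle, so the closure contains
  \<open>(1 - v) / (1 - u)\<close>; and \<open>1 / (1 - v)\<close> runs through the line \<open>1/2 + i \<real>\<close> when \<open>v \<noteq> 1\<close> runs
  through the circle.
\<close>

lemma closure_divisor_sigma_prime_powers:
  fixes b y :: real
  assumes p: "prime p" and irr: "b * ln (real p) / (2 * pi) \<notin> \<rat>"
  defines "u \<equiv> nat_cpow (\<i> * of_real b) p"
  shows "inverse ((1 - u) / 2 * (1 + \<i> * of_real y)) \<in>
           closure (range (\<lambda>k. divisor_sigma (\<i> * of_real b) (p ^ k)))"
proof -
  define \<theta> where "\<theta> = b * ln (real p) / (2 * pi)"
  have u: "u = cis (2 * pi * \<theta>)"
    by (simp add: u_def \<theta>_def nat_cpow_def cis_conv_exp mult_ac)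
  have u1: "u \<noteq> 1"
  proof
    assume "u = 1"
    then have "cis (2 * pi * \<theta>) ^ Suc k = 1" for k by (simp add: u)
    then have "- 1 \<in> closure {1 :: complex}"
      using powers_dense_in_unit_circle[of \<theta> "-1"] irr by (simp add: \<theta>_def)
    then show False by simp
  qed
  have y: "1 + \<i> * complex_of_real y \<noteq> 0" by (simp add: complex_eq_iff)
  \<comment> \<open>the point of the unit circle for which the geometric sum takes the required value\<close>
  define v where "v = 1 - 2 / (1 + \<i> * complex_of_real y)"
  have "v = - (1 - \<i> * complex_of_real y) / (1 + \<i> * complex_of_real y)"
    using y by (simp add: v_def field_simps)
  moreover have "norm (- (1 - \<i> * complex_of_real y)) = norm (1 + \<i> * complex_of_real y)"
    by (simp add: cmod_def)
  ultimately have "norm v = 1"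
    using y by (simp only: norm_divide) simp
  then have "v \<in> closure (range (\<lambda>k. u ^ Suc k))"
    unfolding u using irr by (intro powers_dense_in_unit_circle) (simp_all add: \<theta>_def)
  moreover have "(\<lambda>w. (1 - w) / (1 - u)) ` closure (range (\<lambda>k. u ^ Suc k))
      \<subseteq> closure ((\<lambda>w. (1 - w) / (1 - u)) ` range (\<lambda>k. u ^ Suc k))"
    using u1 by (intro image_closure_subset closure_subset) (auto intro!: continuous_intros)
  ultimately have "(1 - v) / (1 - u) \<in> closure (range (\<lambda>k. (1 - u ^ Suc k) / (1 - u)))"
    by (auto simp: image_image)
  moreover have "(1 - u ^ Suc k) / (1 - u) = divisor_sigma (\<i> * of_real b) (p ^ k)" for k
    using divisor_sigma_prime_power_mult[OF p, of "\<i> * of_real b" k] u1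
    unfolding u_def by (metis divide_eq_eq eq_iff_diff_eq_0)
  moreover have "(1 - v) / (1 - u) = inverse ((1 - u) / 2 * (1 + \<i> * of_real y))"
    using u1 y by (simp add: v_def field_simps)
  ultimately show ?thesis by simp
qed

text \<open>
  The numbers \<open>x\<close> and \<open>y\<close> must have sum \<open>Im P\<close> and product \<open>1 - Re P\<close>; the hypothesis says that the
  quadratic with these coefficients has nonnegative discriminant.
\<close>

lemma product_of_two_vertical_line_points:
  fixes P :: complex
  assumes "(Im P)\<^sup>2 + 4 * Re P \<ge> 4"
  obtains x y :: real where "P = (1 + \<i> * of_real x) * (1 + \<i> * of_real y)"
proof
  define D where "D = sqrt ((Im P)\<^sup>2 + 4 * Re P - 4)"
  have D: "D * D = (Im P)\<^sup>2 + 4 * Re P - 4" using assms by (simp add: D_def)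
  show "P = (1 + \<i> * of_real ((Im P + D) / 2)) * (1 + \<i> * of_real ((Im P - D) / 2))"
    using D by (simp add: complex_eq_iff field_simps power2_eq_square)
qed

text \<open>
  Two factors miss only the inside of a parabola around the negative real axis. Dividing by
  \<open>1 \<plusminus> i\<close> first turns a large number out of that region.
\<close>

lemma product_of_three_vertical_line_points:
  fixes T :: complex
  assumes "norm T \<ge> 10"
  obtains x y z :: real
    where "T = (1 + \<i> * of_real x) * (1 + \<i> * of_real y) * (1 + \<i> * of_real z)"
proof -
  define X Y where "X = Re T" and "Y = Im T"
  have XY: "\<bar>X\<bar> + \<bar>Y\<bar> \<ge> 10"
    using cmod_le[of T] assms by (simp add: X_def Y_def)
  \<comment> \<open>the third factor is \<open>1\<close> or \<open>1 \<plusminus> \<i>\<close>, on the side of the imaginary part\<close>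
  have "\<exists>z::real. (Im (T / (1 + \<i> * of_real z)))\<^sup>2 + 4 * Re (T / (1 + \<i> * of_real z)) \<ge> 4"
  proof (cases "X \<ge> 1")
    case True
    then have "(Im T)\<^sup>2 + 4 * Re T \<ge> 4" by (simp add: X_def add_increasing)
    then show ?thesis by (intro exI[of _ 0]) simp
  next
    case False
    define z :: real where "z = (if Y \<ge> 0 then 1 else -1)"
    have zz: "z * z = 1" "z * Y = \<bar>Y\<bar>" by (auto simp: z_def)
    have "T / (1 + \<i> * of_real z) = Complex ((X + z * Y) / 2) ((Y - z * X) / 2)"
    proof -
      have "1 + \<i> * complex_of_real z \<noteq> 0" by (simp add: complex_eq_iff)
      moreover have "T = Complex ((X + z * Y) / 2) ((Y - z * X) / 2) * (1 + \<i> * of_real z)"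
        using zz(1) by (simp add: complex_eq_iff X_def Y_def field_simps)
      ultimately show ?thesis by (simp add: divide_eq_eq)
    qed
    moreover have "((Y - z * X) / 2)\<^sup>2 + 4 * ((X + z * Y) / 2) \<ge> 4"
    proof -
      have "(Y - z * X)\<^sup>2 = (z * Y)\<^sup>2 - 2 * (z * Y) * X + X\<^sup>2"
        by (simp add: z_def power2_eq_square algebra_simps)
      also have "\<dots> = (\<bar>Y\<bar> - X)\<^sup>2"
        unfolding zz by (simp add: power2_eq_square algebra_simps)
      finally have square: "((Y - z * X) / 2)\<^sup>2 = (\<bar>Y\<bar> - X)\<^sup>2 / 4"
        by (simp add: power_divide)
      have "D\<^sup>2 / 4 + 4 * ((X + \<bar>Y\<bar>) / 2) \<ge> 4" if D: "D = \<bar>Y\<bar> - X" for D :: real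
      proof (cases "X \<ge> 0")
        case True
        then have "4 * ((X + \<bar>Y\<bar>) / 2) \<ge> 4" using XY by simp
        moreover have "D\<^sup>2 / 4 \<ge> 0" by simp
        ultimately show ?thesis by linarith
      next
        case False
        then have "D \<ge> 10" "X + \<bar>Y\<bar> \<ge> - D"
          using XY D by auto
        moreover from this have "10 * D \<le> D\<^sup>2"
          using mult_right_mono[of 10 D D] by (simp add: power2_eq_square)
        moreover have "4 \<le> S / 4 + 4 * (E / 2)" if "10 \<le> D" "- D \<le> E" "10 * D \<le> S" for S E :: real
          using that by linarith
        ultimately show ?thesis by blast
      qed
      then show ?thesis
        unfolding square zz by blast
    qed
    ultimately show ?thesis by (intro exI[of _ z]) simp
  qed
  then obtain z :: real where z: "(Im (T / (1 + \<i> * of_real z)))\<^sup>2 + 4 * Re (T / (1 + \<i> * of_real z)) \<ge> 4"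
    by blast
  obtain x y :: real where "T / (1 + \<i> * of_real z) = (1 + \<i> * of_real x) * (1 + \<i> * of_real y)"
    using product_of_two_vertical_line_points[OF z] .
  moreover have "1 + \<i> * complex_of_real z \<noteq> 0" by (simp add: complex_eq_iff)
  ultimately show thesis
    using that[of x y z] by (simp add: divide_eq_eq)
qed

text \<open>
  Three factors do the work; the others are \<open>1\<close>.
\<close>

lemma product_of_many_vertical_line_points:
  fixes T :: complex
  assumes "finite F" "card F \<ge> 3" "norm T \<ge> 10"
  obtains y :: "'i \<Rightarrow> real" where "(\<Prod>i\<in>F. 1 + \<i> * of_real (y i)) = T"
proof -
  obtain G where G: "G \<subseteq> F" "card G = 3"
    using assms(2) obtain_subset_with_card_n by metis
  then obtain i j k where ijk: "G = {i, j, k}" "i \<noteq> j" "j \<noteq> k" "i \<noteq> k"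
    by (auto simp: card_3_iff)
  obtain a b c :: real where T: "T = (1 + \<i> * of_real a) * (1 + \<i> * of_real b) * (1 + \<i> * of_real c)"
    using product_of_three_vertical_line_points[OF assms(3)] .
  define y where "y = (\<lambda>_. 0 :: real)(i := a, j := b, k := c)"
  have "(\<Prod>l\<in>F. 1 + \<i> * of_real (y l)) = (\<Prod>l\<in>G. 1 + \<i> * of_real (y l))"
    using G(1) assms(1) by (intro prod.mono_neutral_right) (auto simp: y_def ijk(1))
  also have "\<dots> = T"
    using ijk by (simp add: y_def T mult_ac)
  finally show thesis using that by blast
qed

lemma log_ratio_primes_irrational:
  assumes "prime p" "prime q" "p \<noteq> q"
  shows "ln (real p) / ln (real q) \<notin> \<rat>"
proof
  assume rat: "ln (real p) / ln (real q) \<in> \<rat>"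
  have gt: "p > 1" "q > 1" using assms prime_gt_1_nat by auto
  then have pos: "ln (real p) > 0" "ln (real q) > 0" by auto
  obtain m n :: nat where n: "n \<noteq> 0" "\<bar>ln (real p) / ln (real q)\<bar> = real m / real n"
    using Rats_abs_nat_div_natE[OF rat] by metis
  then have "real n * ln (real p) = real m * ln (real q)"
    using pos by (simp add: field_simps)
  then have "ln (real (p ^ n)) = ln (real (q ^ m))"
    using gt by (simp add: ln_realpow)
  then have "p ^ n = q ^ m"
    using gt by (subst (asm) ln_inj_iff) (auto simp flip: of_nat_power)
  then have "p dvd q ^ m"
    using n(1) by (metis dvd_power gr0I)
  then show False
    using assms prime_dvd_power primes_dvd_imp_eq by blast
qed

text \<open>
  The condition says that \<open>p\<^bsup>ib\<^esup>\<close> is a root of unity. It thus costs a single prime to have dense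
  powers everywhere.
\<close>

lemma at_most_one_prime_rational:
  fixes b :: real
  assumes "b \<noteq> 0" "prime p" "prime q" "b * ln (real p) / (2 * pi) \<in> \<rat>" "b * ln (real q) / (2 * pi) \<in> \<rat>"
  shows "p = q"
proof (rule ccontr)
  assume "p \<noteq> q"
  have "(b * ln (real p) / (2 * pi)) / (b * ln (real q) / (2 * pi)) \<in> \<rat>"
    using assms(4,5) by (rule Rats_divide)
  also have "(b * ln (real p) / (2 * pi)) / (b * ln (real q) / (2 * pi)) = ln (real p) / ln (real q)"
    using assms(1) by simp
  finally show False
    using log_ratio_primes_irrational[OF assms(2,3) \<open>p \<noteq> q\<close>] by blast
qed

text \<open>
  By the double-angle formula, \<open>cos (2 b ln p) < 3/4\<close> keeps \<open>cos (b ln p)\<close> above \<open>-15/16\<close>, and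
  \<open>\<bar>1 - p\<^bsup>ib\<^esup>\<bar>\<^sup>2 = 2 - 2 cos (b ln p)\<close>.
\<close>

lemma infinite_primes_contracting:
  fixes b :: real
  assumes "b \<noteq> 0"
  shows "infinite {p. prime p \<and> b * ln (real p) / (2 * pi) \<notin> \<rat> \<and>
           (norm ((1 - nat_cpow (\<i> * of_real b) p) / 2))\<^sup>2 \<le> 31 / 32}" (is "infinite ?S")
proof
  assume fin: "finite ?S"
  let ?Q = "{p. prime p \<and> b * ln (real p) / (2 * pi) \<in> \<rat>}"
  have fin_Q: "finite ?Q"
  proof (cases "?Q = {}")
    case True
    then show ?thesis by (simp only: finite.emptyI)
  next
    case False
    then obtain q where "q \<in> ?Q" by blast
    then have "?Q \<subseteq> {q}" using at_most_one_prime_rational[OF assms] by blast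
    then show ?thesis by (rule finite_subset) simp
  qed
  have sub: "{p. prime p \<and> cos (2 * b * ln (real p)) < 3 / 4} \<subseteq> ?S \<union> ?Q"
  proof
    fix p assume "p \<in> {p. prime p \<and> cos (2 * b * ln (real p)) < 3 / 4}"
    then have p: "prime p" "cos (2 * b * ln (real p)) < 3 / 4" by auto
    define x where "x = cos (b * ln (real p))"
    have "2 * x\<^sup>2 - 1 < 3 / 4"
      using p(2) cos_double_cos[of "b * ln (real p)"] by (simp add: x_def mult_ac)
    then have "x\<^sup>2 < (15/16)\<^sup>2"
      by (simp add: power2_eq_square)
    then have x: "- (15/16) < x"
      using abs_le_square_iff[of "15/16" x] by linarith
    have "nat_cpow (\<i> * of_real b) p = cis (b * ln (real p))"
      by (simp add: nat_cpow_def cis_conv_exp mult_ac)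
    then have "(norm (1 - nat_cpow (\<i> * of_real b) p))\<^sup>2 = (1 - x)\<^sup>2 + (sin (b * ln (real p)))\<^sup>2"
      by (simp add: cmod_power2 x_def)
    also have "\<dots> = 2 - 2 * x"
      using sin_cos_squared_add[of "b * ln (real p)"] by (simp add: x_def power2_eq_square algebra_simps)
    finally have "(norm ((1 - nat_cpow (\<i> * of_real b) p) / 2))\<^sup>2 = (2 - 2 * x) / 4"
      by (simp add: norm_divide power_divide)
    then have "(norm ((1 - nat_cpow (\<i> * of_real b) p) / 2))\<^sup>2 \<le> 31 / 32"
      using x by simp
    then show "p \<in> ?S \<union> ?Q" using p by auto
  qed
  have "finite {p. prime p \<and> cos (2 * b * ln (real p)) < 3 / 4}"
    by (rule finite_subset[OF sub finite_UnI[OF fin fin_Q]])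
  then show False
    using infinite_primes_cos_less[of "2 * b"] assms by simp
qed

section \<open>Purely imaginary exponents and the trichotomy\<close>

text \<open>
  To reach \<open>w \<noteq> 0\<close>, the set \<open>F\<close> of primes is taken so large that the product of the factors
  \<open>(1 - p\<^bsup>ib\<^esup>) / 2\<close> is at most \<open>1/10\<close> of \<open>1 / w\<close> in modulus. The remaining quotient has modulus at
  least \<open>10\<close>, and is therefore a product of factors \<open>1 + i y\<close>.
\<close>

lemma closure_divisor_range_Re_0:
  fixes b :: real
  assumes "b \<noteq> 0"
  shows "closure (divisor_range (\<i> * of_real b)) = UNIV"
proof -
  let ?c = "\<i> * complex_of_real b"
  let ?r = "\<lambda>p. (1 - nat_cpow ?c p) / 2"
  have "w \<in> closure (divisor_range ?c)" if w: "w \<noteq> 0" for w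
  proof -
    define W where "W = inverse w"
    have W: "W \<noteq> 0" using w by (simp add: W_def)
    have "(\<lambda>m. 10 * sqrt (31 / 32) ^ m) \<longlonglongrightarrow> 0"
      by (intro tendsto_mult_right_zero LIMSEQ_power_zero) simp
    then have "eventually (\<lambda>m. 10 * sqrt (31 / 32) ^ m < norm W) sequentially"
      by (rule order_tendstoD) (use W in simp)
    then obtain N where "\<And>m. m \<ge> N \<Longrightarrow> 10 * sqrt (31 / 32) ^ m < norm W"
      unfolding eventually_sequentially by blast
    then obtain m where m: "m \<ge> 3" "10 * sqrt (31 / 32) ^ m < norm W"
      by (metis max.cobounded1 max.cobounded2)
    obtain F where F: "finite F" "card F = m" and
      FS: "F \<subseteq> {p. prime p \<and> b * ln (real p) / (2 * pi) \<notin> \<rat> \<and> (norm (?r p))\<^sup>2 \<le> 31 / 32}"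
      using infinite_arbitrarily_large[OF infinite_primes_contracting[OF assms]] by blast
    have "norm (?r p) \<le> sqrt (31 / 32)" if "p \<in> F" for p
      using FS that real_le_rsqrt by blast
    then have "norm (\<Prod>p\<in>F. ?r p) \<le> (\<Prod>p\<in>F. sqrt (31 / 32))"
      unfolding prod_norm[symmetric] by (intro prod_mono conjI norm_ge_zero)
    then have A: "10 * norm (\<Prod>p\<in>F. ?r p) \<le> norm W"
      using m F by simp
    have A0: "(\<Prod>p\<in>F. ?r p) \<noteq> 0"
    proof -
      have "?r p \<noteq> 0" if "p \<in> F" for p
      proof
        assume "?r p = 0"
        then have *: "exp (\<i> * of_real (b * ln (real p))) = 1"
          by (simp add: nat_cpow_def mult_ac)
        then have "\<exists>n. b * ln (real p) = of_int (2 * n) * pi"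
          by (simp add: exp_eq_1)
        then obtain n :: int where "b * ln (real p) / (2 * pi) = of_int n"
          by (auto simp: field_simps)
        then show False using FS that by auto
      qed
      then show ?thesis using F by simp
    qed
    obtain y where y: "(\<Prod>p\<in>F. 1 + \<i> * of_real (y p)) = W / (\<Prod>p\<in>F. ?r p)"
    proof (rule product_of_many_vertical_line_points[of F "W / (\<Prod>p\<in>F. ?r p)"])
      show "norm (W / (\<Prod>p\<in>F. ?r p)) \<ge> 10"
        using A A0 by (simp add: norm_divide field_simps)
    qed (use F m in auto)
    let ?z = "\<lambda>p. inverse (?r p * (1 + \<i> * of_real (y p)))"
    have "(\<Prod>p\<in>F. ?z p) \<in> closure {\<Prod>p\<in>F. divisor_sigma ?c (p ^ k p) | k. True}"
      using F FS by (intro prod_mem_closure closure_divisor_sigma_prime_powers) auto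
    also have "(\<Prod>p\<in>F. ?z p) = inverse ((\<Prod>p\<in>F. ?r p) * (\<Prod>p\<in>F. 1 + \<i> * of_real (y p)))"
      by (simp only: prod_inversef[unfolded comp_def] prod.distrib)
    also have "\<dots> = w"
      using A0 w by (simp add: y W_def)
    finally have "w \<in> closure {\<Prod>p\<in>F. divisor_sigma ?c (p ^ k p) | k. True}" .
    moreover have "{\<Prod>p\<in>F. divisor_sigma ?c (p ^ k p) | k. True} \<subseteq> divisor_range ?c"
    proof clarify
      fix k :: "nat \<Rightarrow> nat"
      have "(\<Prod>p\<in>F. divisor_sigma ?c (p ^ k p)) = divisor_sigma ?c (\<Prod>p\<in>F. p ^ k p)"
        using F FS by (intro divisor_sigma_prod_prime_powers[symmetric]) auto
      moreover have "(\<Prod>p\<in>F. p ^ k p) > 0"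
        using FS by (intro prod_pos) (auto intro!: prime_gt_0_nat)
      ultimately show "(\<Prod>p\<in>F. divisor_sigma ?c (p ^ k p)) \<in> divisor_range ?c"
        by (auto simp: divisor_range_def)
    qed
    ultimately show ?thesis using closure_mono by blast
  qed
  then have "UNIV - {0} \<subseteq> closure (divisor_range ?c)" by auto
  then have "closure (UNIV - {0 :: complex}) \<subseteq> closure (divisor_range ?c)"
    by (simp add: closure_minimal)
  moreover have "closure (UNIV - {0 :: complex}) = UNIV"
    by (metis Compl_eq_Diff_UNIV closure_complement interior_singleton Compl_empty_eq)
  ultimately show ?thesis by auto
qed

lemma dense_imp_no_isolated_points:
  fixes S :: "'a :: {t1_space, perfect_space} set"
  assumes "closure S = UNIV"
  shows "\<not> z isolated_in S"
proof
  assume "z isolated_in S"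
  then obtain T where T: "open T" "T \<inter> S = {z}"
    by (auto simp: isolated_in_def)
  have "open (T - {z})" using T(1) by (intro open_Diff) auto
  moreover have "T - {z} \<noteq> {}"
    using T not_open_singleton[of z] by (metis Diff_eq_empty_iff IntD1 insertI1 subset_singletonD empty_iff)
  ultimately have "(T - {z}) \<inter> S \<noteq> {}"
    using assms open_Int_closure_eq_empty[of "T - {z}" S] by auto
  then show False using T by blast
qed

theorem theorem2p2:
  fixes c :: complex and a :: real
  assumes "a = Re c"
  shows "(a < 0 \<longrightarrow> \<not> (\<exists>z. z isolated_in divisor_range c)) \<and>
         (a = 0 \<and> c \<noteq> 0 \<longrightarrow>
            closure (divisor_range c) = UNIV \<and> \<not> (\<exists>z. z isolated_in divisor_range c)) \<and>
         (a > 0 \<or> c = 0 \<longrightarrow> (\<forall>z\<in>divisor_range c. z isolated_in divisor_range c))"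
proof (intro conjI impI; (elim conjE)?)
  assume "a < 0"
  then show "\<not> (\<exists>z. z isolated_in divisor_range c)"
    using divisor_range_no_isolated_points_Re_neg assms by blast
next
  assume "a = 0" "c \<noteq> 0"
  then have "c = \<i> * of_real (Im c)" "Im c \<noteq> 0"
    using assms by (auto simp: complex_eq_iff)
  then show dense: "closure (divisor_range c) = UNIV"
    using closure_divisor_range_Re_0 by metis
  then show "\<not> (\<exists>z. z isolated_in divisor_range c)"
    using dense_imp_no_isolated_points by blast
next
  assume "a > 0 \<or> c = 0"
  then show "\<forall>z\<in>divisor_range c. z isolated_in divisor_range c"
    using divisor_range_isolated_Re_pos divisor_range_isolated_0 assms by blast
qed

end
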